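(* Let $\ker(A)=\{0\}$ and for all $i\in\{1,\dots,n_{\mathrm{spec}}\}$ let there exist a sensitivity function $s_{b_i}$ (with $b_i\in\{1,\dots,n_{\mathrm{bin}}\}$) such that $\int_{I_j}s_{b_i}(E)\,\mathrm{d}E\neq 0$ for all $j\in\{1,\dots,n_{\mathrm{spec}}\}$ with $j\geq i$ and $\int_{I_j}s_{b_i}(E)\,\mathrm{d}E=0$ for all $j\in\{1,\dots,n_{\mathrm{spec}}\}$ with $j<i$. Then the bin-sinogram function $\Phi$ is injective on $\mathbb{R}^{n_{\mathrm{mat}}}$.
   Context: Let $n_{\mathrm{bin}},n_{\mathrm{spec}},n_{\mathrm{mat}}\ge 1$ be integers, $c>0$ a real number, and $0<E_1<E_2<\dots<E_{n_{\mathrm{spec}}}<E_{\max}$ real numbers (binding energies and the maximal X-ray energy). Set $E_{n_{\mathrm{spec}}+1}:=E_{\max}$ and define the spectral intervals $I_i=[E_i,E_{i+1})$ for $i=1,\dots,n_{\mathrm{spec}}$. For $b=1,\dots,n_{\mathrm{bin}}$ let $s_b:[0,E_{\max}]\to[0,\infty)$ be the sensitivity functions, which are nonnegative and (Lebesgue) integrable. For $m=1,\dots,n_{\mathrm{mat}}$ let $a_m^{(i)}\in\mathbb{R}$, $i=1,\dots,n_{\mathrm{spec}}$, be the coefficients of the attenuation spectrum of material $m$, i.e. $\mu_m(E)=E^{-c}\sum_{i=1}^{n_{\mathrm{spec}}}a_m^{(i)}\mathbf{1}_{I_i}(E)$. Let $A\in\mathbb{R}^{n_{\mathrm{spec}}\times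 n_{\mathrm{mat}}}$ be the matrix whose entry in row $i$ and column $m$ is $a_m^{(i)}$. The bin-sinogram function $\Phi=(\Phi_1,\dots,\Phi_{n_{\mathrm{bin}}})$ is the map $\mathbb{R}^{n_{\mathrm{mat}}}\to\mathbb{R}^{n_{\mathrm{bin}}}$ given by $$\Phi_b(z)=\sum_{i=1}^{n_{\mathrm{spec}}}\int_{I_i}s_b(E)\exp\Big(-E^{-c}\sum_{m=1}^{n_{\mathrm{mat}}}a_m^{(i)}z_m\Big)\,\mathrm{d}E,\qquad b=1,\dots,n_{\mathrm{bin}}.$$ *)

theory Defs
  imports "HOL-Analysis.Analysis" "Jordan_Normal_Form.Matrix_Kernel"
begin

unbundle no vec_syntax

text \<open>
  Spectral intervals, energy bins and materials are indexed from 0, as are the vectors and matrices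
  of \<^theory>\<open>Jordan_Normal_Form.Matrix\<close>.  So \<^term>\<open>E i\<close> for
  \<^term>\<open>i < n_spec\<close> is the binding energy usually written $E_{i+1}$, and the last
  interval is closed off by the maximal energy.
\<close>

definition spectral_interval :: "nat \<Rightarrow> (nat \<Rightarrow> real) \<Rightarrow> real \<Rightarrow> nat \<Rightarrow> real set" where
  "spectral_interval n_spec E E_max i = {E i ..< (if Suc i < n_spec then E (Suc i) else E_max)}"

text \<open>
  \<^term>\<open>a m i\<close> is the coefficient of material \<^term>\<open>m\<close> on spectral interval
  \<^term>\<open>i\<close>; spectral intervals are the rows of the matrix.
\<close>

definition attenuation_matrix :: "nat \<Rightarrow> nat \<Rightarrow> (nat \<Rightarrow> nat \<Rightarrow> real) \<Rightarrow> real mat" where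
  "attenuation_matrix n_spec n_mat a = mat n_spec n_mat (\<lambda>(i, m). a m i)"

definition bin_sinogram ::
  "nat \<Rightarrow> nat \<Rightarrow> nat \<Rightarrow> real \<Rightarrow> (nat \<Rightarrow> real) \<Rightarrow> real \<Rightarrow> (nat \<Rightarrow> real \<Rightarrow> real) \<Rightarrow>
    (nat \<Rightarrow> nat \<Rightarrow> real) \<Rightarrow> real vec \<Rightarrow> real vec" where
  "bin_sinogram n_bin n_spec n_mat c E E_max s a z =
     vec n_bin (\<lambda>b. \<Sum>i<n_spec.
       LINT x : spectral_interval n_spec E E_max i | lebesgue.
         s b x * exp (- (x powr (- c) * (\<Sum>m<n_mat. a m i * z $ m))))"

end

theory Submission
  imports Defs
begin

text \<open>
  Write $y_i = \sum_m a_m^{(i)} z_m$ for the coordinates of $Az$.  Since $\ker A = \{0\}$, it suffices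
  to show that $\Phi(z)$ determines $y$.  In terms of $y$, the sinogram of bin $b$ is
  $\sum_i F_{b,i}(y_i)$ with the single-interval transforms
  $F_{b,i}(t) = \int_{I_i} s_b(x) \exp(-x^{-c} t)\,dx$, each depending on one coordinate only.

  A nonnegative sensitivity with vanishing integral over $I_i$ is zero almost everywhere there, so
  $F_{b,i}$ is identically zero; otherwise $F_{b,i}$ is strictly decreasing, because
  the kernel is strictly decreasing in $t$ at every energy (\<open>inj_exponential_transform\<close>).
  Both facts come from one principle: multiplying a nonnegative function by a strictly positive
  weight does not change whether its integral vanishes (\<open>set_integral_pos_weight_eq_0_iff\<close>).

  The hypothesis on the bins $b_i$ therefore makes the system $\sum_j F_{b_i,j}(y_j) = \Phi_{b_i}(z)$
  upper triangular with injective diagonal, and back substitution from the last interval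
  downwards recovers $y$ (\<open>triangular_sums_determine\<close>).
\<close>

text \<open>
  Both integrands are nonnegative, so each integral vanishes exactly when the integrand is
  zero almost everywhere; a positive weight does not affect where a product is zero.
\<close>

lemma set_integral_pos_weight_eq_0_iff:
  fixes f h :: "'a \<Rightarrow> real"
  assumes f: "set_integrable M S f" and fh: "set_integrable M S (\<lambda>x. f x * h x)"
    and nonneg: "\<And>x. x \<in> S \<Longrightarrow> 0 \<le> f x" and pos: "\<And>x. x \<in> S \<Longrightarrow> 0 < h x"
  shows "(LINT x : S | M. f x * h x) = 0 \<longleftrightarrow> (LINT x : S | M. f x) = 0"
proof -
  have "(LINT x : S | M. f x) = 0 \<longleftrightarrow> (AE x in M. indicator S x * f x = 0)"
    unfolding set_lebesgue_integral_def real_scaleR_def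
    using f nonneg
    by (intro integral_nonneg_eq_0_iff_AE)
       (auto simp: set_integrable_def indicator_def)
  moreover have "(LINT x : S | M. f x * h x) = 0 \<longleftrightarrow> (AE x in M. indicator S x * (f x * h x) = 0)"
    unfolding set_lebesgue_integral_def real_scaleR_def
    using fh nonneg pos
    by (intro integral_nonneg_eq_0_iff_AE)
       (auto simp: set_integrable_def indicator_def less_imp_le)
  moreover have "indicator S x * (f x * h x) = 0 \<longleftrightarrow> indicator S x * f x = 0" for x
    using pos[of x] by (auto simp: indicator_def)
  ultimately show ?thesis by simp
qed

text \<open>
  Away from $x = 0$ the kernel is bounded, which is where the positivity of the smallest
  binding energy enters.
\<close>

lemma set_integrable_exponential_kernel:
  fixes f :: "real \<Rightarrow> real"
  assumes f: "set_integrable lebesgue S f" and l: "0 < l" "S \<subseteq> {l..}" and c: "0 < c"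
  shows "set_integrable lebesgue S (\<lambda>x. f x * exp (- (x powr (- c) * t)))"
proof -
  define B where "B = exp (l powr (- c) * \<bar>t\<bar>)"
  have f': "integrable lebesgue (\<lambda>x. indicator S x * f x)"
    using f by (simp add: set_integrable_def)
  have kernel_meas: "(\<lambda>x::real. exp (- (x powr (- c) * t))) \<in> borel_measurable lebesgue"
    by (rule measurable_completion) measurable
  have kernel_le: "exp (- (x powr (- c) * t)) \<le> B" if "x \<in> S" for x
  proof -
    have "x powr (- c) \<le> l powr (- c)"
      using that l c by (intro powr_mono2') auto
    then have "x powr (- c) * \<bar>t\<bar> \<le> l powr (- c) * \<bar>t\<bar>"
      by (intro mult_right_mono) auto
    moreover have "- (x powr (- c) * t) \<le> x powr (- c) * \<bar>t\<bar>"
      by (metis abs_ge_minus_self abs_mult abs_of_nonneg powr_ge_zero)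
    ultimately show ?thesis
      by (simp add: B_def)
  qed
  have "integrable lebesgue (\<lambda>x. indicator S x * f x * exp (- (x powr (- c) * t)))"
  proof (rule Bochner_Integration.integrable_bound)
    show "integrable lebesgue (\<lambda>x. B * (indicator S x * f x))"
      using f' by simp
    show "(\<lambda>x. indicator S x * f x * exp (- (x powr (- c) * t))) \<in> borel_measurable lebesgue"
      using borel_measurable_times[OF borel_measurable_integrable[OF f'] kernel_meas] .
    have "\<bar>indicator S x * f x * exp (- (x powr (- c) * t))\<bar> \<le> \<bar>B * (indicator S x * f x)\<bar>" for x
    proof (cases "x \<in> S")
      case True
      then have "\<bar>f x\<bar> * exp (- (x powr (- c) * t)) \<le> \<bar>f x\<bar> * B"
        using kernel_le by (intro mult_left_mono) auto
      with True show ?thesis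
        by (simp add: abs_mult B_def mult.commute)
    qed simp
    then show "AE x in lebesgue. norm (indicator S x * f x * exp (- (x powr (- c) * t)))
        \<le> norm (B * (indicator S x * f x))"
      by simp
  qed
  then show ?thesis
    by (simp add: set_integrable_def mult.assoc)
qed

text \<open>
  For $t < t'$ the difference of the two transform values is the integral of $f$ against
  the difference of the kernels.  That difference is a strictly positive weight, so the values
  can only agree if $f$ itself has integral zero.
\<close>

lemma inj_exponential_transform:
  fixes f :: "real \<Rightarrow> real"
  assumes f: "set_integrable lebesgue S f" and l: "0 < l" "S \<subseteq> {l..}" and c: "0 < c"
    and nonneg: "\<And>x. x \<in> S \<Longrightarrow> 0 \<le> f x"
    and nonzero: "(LINT x : S | lebesgue. f x) \<noteq> 0"
  shows "inj (\<lambda>t. LINT x : S | lebesgue. f x * exp (- (x powr (- c) * t)))"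
    (is "inj ?F")
proof (rule linorder_injI)
  fix t t' :: real
  assume "t < t'"
  define h where "h x = exp (- (x powr (- c) * t)) - exp (- (x powr (- c) * t'))" for x
  note kernel_int = set_integrable_exponential_kernel[OF f l c]
  have fh_eq: "(\<lambda>x. f x * h x) =
      (\<lambda>x. f x * exp (- (x powr (- c) * t)) - f x * exp (- (x powr (- c) * t')))"
    by (simp add: h_def right_diff_distrib)
  have fh: "set_integrable lebesgue S (\<lambda>x. f x * h x)"
    unfolding fh_eq by (intro set_integral_diff kernel_int)
  have diff: "(LINT x : S | lebesgue. f x * h x) = ?F t - ?F t'"
    unfolding fh_eq by (intro set_integral_diff kernel_int)
  have "0 < h x" if "x \<in> S" for x
  proof -
    have "0 < x powr (- c)"
      using that l by auto
    with \<open>t < t'\<close> show ?thesis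
      by (simp add: h_def)
  qed
  then have "(LINT x : S | lebesgue. f x * h x) \<noteq> 0"
    using set_integral_pos_weight_eq_0_iff[OF f fh nonneg] nonzero by blast
  with diff show "?F t \<noteq> ?F t'"
    by simp
qed

text \<open>
  Back substitution for a nonlinear triangular system: once the coordinates beyond $i$ are known
  to agree, the equation chosen for $i$ has only its diagonal term left.
\<close>

lemma triangular_sums_determine:
  fixes F :: "'b \<Rightarrow> nat \<Rightarrow> 'a \<Rightarrow> 'c::cancel_comm_monoid_add"
  assumes sums: "\<And>b. b \<in> B \<Longrightarrow> (\<Sum>j<n. F b j (y j)) = (\<Sum>j<n. F b j (w j))"
    and triangular: "\<And>i. i < n \<Longrightarrow> \<exists>b\<in>B. inj (F b i) \<and> (\<forall>j<i. \<forall>t. F b j t = 0)"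
    and "i < n"
  shows "y i = w i"
  using \<open>i < n\<close>
proof (induction "n - i" arbitrary: i rule: less_induct)
  case less
  obtain b where b: "b \<in> B" "inj (F b i)" "\<And>j t. j < i \<Longrightarrow> F b j t = 0"
    using triangular[OF less.prems] by blast
  have split: "(\<Sum>j<n. F b j (v j)) = F b i (v i) + (\<Sum>j\<in>{..<n} - {i}. F b j (v j))" for v
    using less.prems by (intro sum.remove) auto
  have "F b j (y j) = F b j (w j)" if "j \<in> {..<n} - {i}" for j
  proof (cases "j < i")
    case True
    then show ?thesis by (simp add: b(3))
  next
    case False
    then have "y j = w j"
      using that less.prems by (intro less.hyps) auto
    then show ?thesis by simp
  qed
  then have "(\<Sum>j\<in>{..<n} - {i}. F b j (y j)) = (\<Sum>j\<in>{..<n} - {i}. F b j (w j))"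
    by (rule sum.cong[OF refl])
  then have "F b i (y i) = F b i (w i)"
    using sums[OF b(1)] by (simp add: split)
  then show ?case
    using b(2) by (simp add: inj_eq)
qed

lemma mult_mat_vec_inj_if_trivial_kernel:
  fixes A :: "'a::comm_ring_1 mat"
  assumes A: "A \<in> carrier_mat n m" and ker: "mat_kernel A = {0\<^sub>v m}"
    and z: "z \<in> carrier_vec m" and z': "z' \<in> carrier_vec m"
    and eq: "A *\<^sub>v z = A *\<^sub>v z'"
  shows "z = z'"
proof -
  have "A *\<^sub>v (z - z') = 0\<^sub>v n"
    using mult_minus_distrib_mat_vec[OF A z z'] eq A z' by simp
  then have "z - z' \<in> mat_kernel A"
    using A z z' by (intro mat_kernelI) auto
  then have diff: "z - z' = 0\<^sub>v m"
    using ker by simp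
  show ?thesis
  proof (rule eq_vecI)
    fix i assume "i < dim_vec z'"
    then have "(z - z') $ i = 0" "i < dim_vec z'"
      using diff z' by auto
    then show "z $ i = z' $ i" by simp
  qed (use z z' in auto)
qed

lemma spectral_interval_subset:
  assumes mono: "\<And>i. Suc i < n_spec \<Longrightarrow> E i < E (Suc i)"
    and last: "E (n_spec - 1) < E_max" and i: "i < n_spec"
  shows "spectral_interval n_spec E E_max i \<subseteq> {E 0..E_max}"
proof -
  have lower: "E 0 \<le> E j" if "j < n_spec" for j
    using that
  proof (induction j)
    case (Suc j)
    then show ?case
      using mono[of j] by simp
  qed simp
  have "j \<le> n_spec - 1 \<Longrightarrow> E j < E_max" for j
  proof (induction rule: inc_induct)
    case (step k)
    then have "E k < E (Suc k)"
      by (intro mono) linarith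
    with step.IH show ?case
      by simp
  qed (rule last)
  then have upper: "(if Suc i < n_spec then E (Suc i) else E_max) \<le> E_max"
    by (simp add: less_imp_le)
  show ?thesis
    unfolding spectral_interval_def using lower[OF i] upper by auto
qed

theorem theorem3p6:
  fixes n_bin n_spec n_mat :: nat
    and c E_max :: real
    and E :: "nat \<Rightarrow> real"
    and s :: "nat \<Rightarrow> real \<Rightarrow> real"
    and a :: "nat \<Rightarrow> nat \<Rightarrow> real"
  assumes "n_bin \<ge> 1" and "n_spec \<ge> 1" and "n_mat \<ge> 1"
    and "c > 0"
    and "0 < E 0"
    and "\<And>i. Suc i < n_spec \<Longrightarrow> E i < E (Suc i)"
    and "E (n_spec - 1) < E_max"
    and "\<And>b x. b < n_bin \<Longrightarrow> x \<in> {0..E_max} \<Longrightarrow> s b x \<ge> 0"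
    and "\<And>b. b < n_bin \<Longrightarrow> set_integrable lebesgue {0..E_max} (s b)"
    and "mat_kernel (attenuation_matrix n_spec n_mat a) = {0\<^sub>v n_mat}"
    and "\<forall>i<n_spec. \<exists>b<n_bin.
           (\<forall>j<n_spec. j \<ge> i \<longrightarrow>
              (LINT x : spectral_interval n_spec E E_max j | lebesgue. s b x) \<noteq> 0) \<and>
           (\<forall>j<n_spec. j < i \<longrightarrow>
              (LINT x : spectral_interval n_spec E E_max j | lebesgue. s b x) = 0)"
  shows "inj_on (bin_sinogram n_bin n_spec n_mat c E E_max s a) (carrier_vec n_mat)"
proof (rule inj_onI)
  fix z z' :: "real vec"
  assume z: "z \<in> carrier_vec n_mat" and z': "z' \<in> carrier_vec n_mat"
    and eq: "bin_sinogram n_bin n_spec n_mat c E E_max s a z =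
      bin_sinogram n_bin n_spec n_mat c E E_max s a z'"
  let ?I = "spectral_interval n_spec E E_max"
  let ?A = "attenuation_matrix n_spec n_mat a"
  define y where "y v i = (\<Sum>m<n_mat. a m i * v $ m)" for v i
  define F where "F b i t = (LINT x : ?I i | lebesgue. s b x * exp (- (x powr (- c) * t)))"
    for b i t
  have I_sub: "?I i \<subseteq> {E 0..E_max}" if "i < n_spec" for i
    using spectral_interval_subset[OF assms(6,7) that] .
  have I_lower: "?I i \<subseteq> {E 0..}" if "i < n_spec" for i
    using I_sub[OF that] by auto
  have s_nonneg: "0 \<le> s b x" if "b < n_bin" "i < n_spec" "x \<in> ?I i" for b i x
    using assms(8)[of b x] I_sub[of i] \<open>0 < E 0\<close> that by fastforce
  have s_int: "set_integrable lebesgue (?I i) (s b)" if "b < n_bin" "i < n_spec" for b i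
    using assms(9)[OF that(1)]
  proof (rule set_integrable_subset)
    show "?I i \<in> sets lebesgue"
      by (simp add: spectral_interval_def)
    show "?I i \<subseteq> {0..E_max}"
      using I_sub[OF that(2)] \<open>0 < E 0\<close> by fastforce
  qed
  have F_zero: "F b i t = 0"
    if "b < n_bin" "i < n_spec" "(LINT x : ?I i | lebesgue. s b x) = 0" for b i t
    unfolding F_def
    using set_integral_pos_weight_eq_0_iff[OF s_int[OF that(1,2)]
        set_integrable_exponential_kernel[OF s_int[OF that(1,2)] \<open>0 < E 0\<close> I_lower \<open>c > 0\<close>]
        s_nonneg[OF that(1,2)]] that
    by simp
  have F_inj: "inj (F b i)"
    if "b < n_bin" "i < n_spec" "(LINT x : ?I i | lebesgue. s b x) \<noteq> 0" for b i
    unfolding F_def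
    using inj_exponential_transform[OF s_int[OF that(1,2)] \<open>0 < E 0\<close> I_lower[OF that(2)] \<open>c > 0\<close>
        s_nonneg[OF that(1,2)] that(3)] .
  have sums: "(\<Sum>i<n_spec. F b i (y z i)) = (\<Sum>i<n_spec. F b i (y z' i))"
    if "b \<in> {..<n_bin}" for b
    using arg_cong[OF eq, of "\<lambda>v. v $ b"] that by (simp add: bin_sinogram_def F_def y_def)
  have triangular: "\<exists>b\<in>{..<n_bin}. inj (F b i) \<and> (\<forall>j<i. \<forall>t. F b j t = 0)"
    if i: "i < n_spec" for i
  proof -
    obtain b where b: "b < n_bin"
      and nonzero: "\<forall>j<n_spec. j \<ge> i \<longrightarrow> (LINT x : ?I j | lebesgue. s b x) \<noteq> 0"
      and zero: "\<forall>j<n_spec. j < i \<longrightarrow> (LINT x : ?I j | lebesgue. s b x) = 0"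
      using assms(11) i by blast
    have "inj (F b i)"
      using F_inj b i nonzero by blast
    moreover have "F b j t = 0" if "j < i" for j t
      using F_zero b i zero that by simp
    ultimately show ?thesis
      using b by blast
  qed
  have y_eq: "y z i = y z' i" if "i < n_spec" for i
    using triangular_sums_determine[where B = "{..<n_bin}" and F = F, OF sums triangular that] .
  have A: "?A \<in> carrier_mat n_spec n_mat"
    by (simp add: attenuation_matrix_def)
  have A_mult: "?A *\<^sub>v v = vec n_spec (y v)" if "v \<in> carrier_vec n_mat" for v
    using that
    by (intro eq_vecI)
       (auto simp: attenuation_matrix_def scalar_prod_def y_def lessThan_atLeast0)
  show "z = z'"
  proof (rule mult_mat_vec_inj_if_trivial_kernel[OF A assms(10) z z'])
    show "?A *\<^sub>v z = ?A *\<^sub>v z'"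
      unfolding A_mult[OF z] A_mult[OF z'] using y_eq by auto
  qed
qed

end
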